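(* Let $G$ be a group with identity element $e$ and let $R$ be a (not necessarily unital) $G$-graded ring. If the $G$-grading on $R$ is non-degenerate and $R_e$ is a domain, then $\operatorname{Supp}(R)$ is a subgroup of $G$.
   Context: Rings are associative, not necessarily commutative. A ring $R$ is $G$-graded if there is a collection $\{R_g\}_{g\in G}$ of additive subgroups of $R$ such that $R=\oplus_{g\in G}R_g$ and $R_gR_h\subseteq R_{gh}$ for all $g,h\in G$. The support of the $G$-grading is $\operatorname{Supp}(R):=\{g\in G\mid R_g\neq\{0\}\}$. The $G$-grading is non-degenerate if, for each $g\in G$ and each nonzero $r_g\in R_g$, we have $r_gR_{g^{-1}}\neq\{0\}$ and $R_{g^{-1}}r_g\neq\{0\}$. A domain is a nonzero (not necessarily commutative or unital) ring in which the product of any two nonzero elements is nonzero. *)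

theory Defs
  imports "HOL-Algebra.Algebra"
begin

text \<open>The library's \<^locale>\<open>ring\<close> and \<^locale>\<open>domain\<close> require a multiplicative identity (and the
  latter also commutativity), so non-unital versions are introduced here. They are stated for the
  library's ring records; the field for the multiplicative identity is left unconstrained.\<close>

locale nonunital_ring = abelian_group R for R (structure) +
  assumes m_closed: "\<lbrakk> x \<in> carrier R; y \<in> carrier R \<rbrakk> \<Longrightarrow> x \<otimes> y \<in> carrier R"
    and m_assoc: "\<lbrakk> x \<in> carrier R; y \<in> carrier R; z \<in> carrier R \<rbrakk>
      \<Longrightarrow> (x \<otimes> y) \<otimes> z = x \<otimes> (y \<otimes> z)"
    and l_distr: "\<lbrakk> x \<in> carrier R; y \<in> carrier R; z \<in> carrier R \<rbrakk>
      \<Longrightarrow> (x \<oplus> y) \<otimes> z = x \<otimes> z \<oplus> y \<otimes> z"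
    and r_distr: "\<lbrakk> x \<in> carrier R; y \<in> carrier R; z \<in> carrier R \<rbrakk>
      \<Longrightarrow> z \<otimes> (x \<oplus> y) = z \<otimes> x \<oplus> z \<otimes> y"

locale nonunital_domain = nonunital_ring +
  assumes nonzero: "carrier R \<noteq> {\<zero>}"
    and integral: "\<lbrakk> x \<in> carrier R; y \<in> carrier R; x \<otimes> y = \<zero> \<rbrakk> \<Longrightarrow> x = \<zero> \<or> y = \<zero>"

text \<open>The homogeneous component of degree \<open>g\<close> is \<open>A g\<close>; the values of \<open>A\<close> outside the carrier of
  \<open>G\<close> are irrelevant. Directness of the sum is expressed by existence and uniqueness of the family
  of homogeneous components of an element, a family being an extensional function on the carrier
  of \<open>G\<close> that is nonzero at only finitely many arguments.\<close>

locale graded_ring = G?: group G + R?: nonunital_ring R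
  for G (structure) and R (structure) +
  fixes A :: "'a \<Rightarrow> 'c set"
  assumes component: "g \<in> carrier G \<Longrightarrow> additive_subgroup (A g) R"
    and direct_sum: "r \<in> carrier R \<Longrightarrow>
      \<exists>!c. c \<in> (\<Pi>\<^sub>E g\<in>carrier G. A g) \<and>
           finite {g \<in> carrier G. c g \<noteq> \<zero>\<^bsub>R\<^esub>} \<and>
           r = (\<Oplus>\<^bsub>R\<^esub>g\<in>{g \<in> carrier G. c g \<noteq> \<zero>\<^bsub>R\<^esub>}. c g)"
    and component_mult: "\<lbrakk> g \<in> carrier G; h \<in> carrier G; x \<in> A g; y \<in> A h \<rbrakk>
      \<Longrightarrow> x \<otimes>\<^bsub>R\<^esub> y \<in> A (g \<otimes>\<^bsub>G\<^esub> h)"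

definition Supp :: "('a, 'b) monoid_scheme \<Rightarrow> ('c, 'd) ring_scheme \<Rightarrow> ('a \<Rightarrow> 'c set) \<Rightarrow> 'a set"
  where "Supp G R A = {g \<in> carrier G. A g \<noteq> {\<zero>\<^bsub>R\<^esub>}}"

text \<open>The product of an element with an additive subgroup is again an additive subgroup, so the set
  of products used here is also the set of finite sums of such products.\<close>

definition nondegenerate_grading ::
    "('a, 'b) monoid_scheme \<Rightarrow> ('c, 'd) ring_scheme \<Rightarrow> ('a \<Rightarrow> 'c set) \<Rightarrow> bool"
  where "nondegenerate_grading G R A \<longleftrightarrow>
    (\<forall>g\<in>carrier G. \<forall>r\<in>A g. r \<noteq> \<zero>\<^bsub>R\<^esub> \<longrightarrow>
       r <#\<^bsub>R\<^esub> A (inv\<^bsub>G\<^esub> g) \<noteq> {\<zero>\<^bsub>R\<^esub>} \<and> A (inv\<^bsub>G\<^esub> g) #>\<^bsub>R\<^esub> r \<noteq> {\<zero>\<^bsub>R\<^esub>})"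

end

theory Submission
  imports Defs
begin

text \<open>A nonzero homogeneous element \<open>a\<close> of degree \<open>g\<close> has, by non-degeneracy, partners
  \<open>a'\<close> and \<open>a''\<close> of degree \<open>g\<inverse>\<close> with \<open>a' a \<noteq> 0\<close> and \<open>a a'' \<noteq> 0\<close>; both products lie in the
  component \<open>R\<^sub>e\<close>. Since a partner of a nonzero element cannot be zero, the support is closed under inverses.

  For closure under products, take nonzero \<open>a\<close> and \<open>b\<close> of degrees \<open>g\<close> and \<open>h\<close>, choose a left
  partner \<open>a'\<close> of \<open>a\<close> and a right partner \<open>b''\<close> of \<open>b\<close>. Then \<open>(a' a) (b b'')\<close> is a product of
  two nonzero elements of the domain \<open>R\<^sub>e\<close>, hence nonzero. By associativity it contains the factor
  \<open>a b\<close>, which is therefore a nonzero element of degree \<open>g h\<close>. Finally, a domain is nonzero by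
  definition, so the identity of the group lies in the support.\<close>

context nonunital_ring
begin

lemma mult_zero_right:
  assumes "x \<in> carrier R"
  shows "x \<otimes> \<zero> = \<zero>"
proof -
  have "x \<otimes> \<zero> \<oplus> x \<otimes> \<zero> = x \<otimes> \<zero> \<oplus> \<zero>"
    using assms r_distr[of \<zero> \<zero> x] m_closed by simp
  then show ?thesis
    using assms m_closed add.l_cancel zero_closed by blast
qed

lemma mult_zero_left:
  assumes "x \<in> carrier R"
  shows "\<zero> \<otimes> x = \<zero>"
proof -
  have "\<zero> \<otimes> x \<oplus> \<zero> \<otimes> x = \<zero> \<otimes> x \<oplus> \<zero>"
    using assms l_distr[of \<zero> \<zero> x] m_closed by simp
  then show ?thesis
    using assms m_closed add.l_cancel zero_closed by blast
qed

end

context graded_ring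
begin

lemma component_subset: "g \<in> carrier G \<Longrightarrow> A g \<subseteq> carrier R"
  using component additive_subgroup.a_subset by blast

lemma zero_in_component: "g \<in> carrier G \<Longrightarrow> \<zero>\<^bsub>R\<^esub> \<in> A g"
  using component additive_subgroup.zero_closed by blast

lemma mem_Supp_iff: "g \<in> Supp G R A \<longleftrightarrow> g \<in> carrier G \<and> (\<exists>a\<in>A g. a \<noteq> \<zero>\<^bsub>R\<^esub>)"
  unfolding Supp_def using zero_in_component by blast

lemma nondegenerate_right_partner:
  assumes "nondegenerate_grading G R A" "g \<in> carrier G" "a \<in> A g" "a \<noteq> \<zero>\<^bsub>R\<^esub>"
  obtains b where "b \<in> A (inv g)" "a \<otimes>\<^bsub>R\<^esub> b \<noteq> \<zero>\<^bsub>R\<^esub>"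
proof -
  have "a <#\<^bsub>R\<^esub> A (inv g) \<noteq> {\<zero>\<^bsub>R\<^esub>}"
    using assms unfolding nondegenerate_grading_def by blast
  moreover have "A (inv g) \<noteq> {}"
    using assms zero_in_component by blast
  ultimately show thesis
    using that unfolding l_coset_def by blast
qed

lemma nondegenerate_left_partner:
  assumes "nondegenerate_grading G R A" "g \<in> carrier G" "a \<in> A g" "a \<noteq> \<zero>\<^bsub>R\<^esub>"
  obtains b where "b \<in> A (inv g)" "b \<otimes>\<^bsub>R\<^esub> a \<noteq> \<zero>\<^bsub>R\<^esub>"
proof -
  have "A (inv g) #>\<^bsub>R\<^esub> a \<noteq> {\<zero>\<^bsub>R\<^esub>}"
    using assms unfolding nondegenerate_grading_def by blast
  moreover have "A (inv g) \<noteq> {}"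
    using assms zero_in_component by blast
  ultimately show thesis
    using that unfolding r_coset_def by blast
qed

lemma Supp_inv_closed:
  assumes "nondegenerate_grading G R A" "g \<in> Supp G R A"
  shows "inv g \<in> Supp G R A"
proof -
  obtain a where g: "g \<in> carrier G" and a: "a \<in> A g" "a \<noteq> \<zero>\<^bsub>R\<^esub>"
    using assms(2) mem_Supp_iff by blast
  obtain b where b: "b \<in> A (inv g)" "a \<otimes>\<^bsub>R\<^esub> b \<noteq> \<zero>\<^bsub>R\<^esub>"
    using nondegenerate_right_partner[OF assms(1) g a] .
  have "b \<noteq> \<zero>\<^bsub>R\<^esub>"
    using b(2) a(1) g component_subset mult_zero_right by blast
  then show ?thesis
    using b(1) g mem_Supp_iff by blast
qed

text \<open>Partners that move \<open>a\<close> and \<open>b\<close> into the identity component are placed on the outer sides,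
  so that the product \<open>a b\<close> stays intact in the middle.\<close>

lemma homogeneous_mult_nonzero:
  assumes nondeg: "nondegenerate_grading G R A"
    and dom: "nonunital_domain (R\<lparr>carrier := A \<one>\<rparr>)"
    and g: "g \<in> carrier G" and a: "a \<in> A g" "a \<noteq> \<zero>\<^bsub>R\<^esub>"
    and h: "h \<in> carrier G" and b: "b \<in> A h" "b \<noteq> \<zero>\<^bsub>R\<^esub>"
  shows "a \<otimes>\<^bsub>R\<^esub> b \<noteq> \<zero>\<^bsub>R\<^esub>"
proof
  assume ab: "a \<otimes>\<^bsub>R\<^esub> b = \<zero>\<^bsub>R\<^esub>"
  obtain a' where a': "a' \<in> A (inv g)" "a' \<otimes>\<^bsub>R\<^esub> a \<noteq> \<zero>\<^bsub>R\<^esub>"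
    using nondegenerate_left_partner[OF nondeg g a] .
  obtain b' where b': "b' \<in> A (inv h)" "b \<otimes>\<^bsub>R\<^esub> b' \<noteq> \<zero>\<^bsub>R\<^esub>"
    using nondegenerate_right_partner[OF nondeg h b] .
  have in_R: "a \<in> carrier R" "b \<in> carrier R" "a' \<in> carrier R" "b' \<in> carrier R"
    using a b a' b' g h component_subset by blast+
  have "a' \<otimes>\<^bsub>R\<^esub> a \<in> A \<one>" "b \<otimes>\<^bsub>R\<^esub> b' \<in> A \<one>"
    using component_mult[of "inv g" g a' a] component_mult[of h "inv h" b b'] a b a' b' g h
    by simp_all
  then have "(a' \<otimes>\<^bsub>R\<^esub> a) \<otimes>\<^bsub>R\<^esub> (b \<otimes>\<^bsub>R\<^esub> b') \<noteq> \<zero>\<^bsub>R\<^esub>"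
    using nonunital_domain.integral[OF dom, of "a' \<otimes>\<^bsub>R\<^esub> a" "b \<otimes>\<^bsub>R\<^esub> b'"] a'(2) b'(2) by auto
  moreover have "(a' \<otimes>\<^bsub>R\<^esub> a) \<otimes>\<^bsub>R\<^esub> (b \<otimes>\<^bsub>R\<^esub> b') = a' \<otimes>\<^bsub>R\<^esub> ((a \<otimes>\<^bsub>R\<^esub> b) \<otimes>\<^bsub>R\<^esub> b')"
    using in_R by (simp add: R.m_assoc R.m_closed)
  ultimately show False
    using ab in_R by (simp add: mult_zero_left mult_zero_right)
qed

end

theorem proposition2p9:
  fixes G :: "('a, 'b) monoid_scheme" and R :: "('c, 'd) ring_scheme" and A :: "'a \<Rightarrow> 'c set"
  assumes "graded_ring G R A"
    and "nondegenerate_grading G R A"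
    and "nonunital_domain (R\<lparr>carrier := A \<one>\<^bsub>G\<^esub>\<rparr>)"
  shows "subgroup (Supp G R A) G"
proof -
  interpret graded_ring G R A by fact
  show ?thesis
  proof
    show "Supp G R A \<subseteq> carrier G"
      unfolding Supp_def by blast
    show "\<one>\<^bsub>G\<^esub> \<in> Supp G R A"
      using nonunital_domain.nonzero[OF assms(3)] unfolding Supp_def by simp
    show "inv\<^bsub>G\<^esub> g \<in> Supp G R A" if "g \<in> Supp G R A" for g
      using Supp_inv_closed[OF assms(2) that] .
    show "g \<otimes>\<^bsub>G\<^esub> h \<in> Supp G R A" if "g \<in> Supp G R A" "h \<in> Supp G R A" for g h
      using that homogeneous_mult_nonzero[OF assms(2,3)] component_mult G.m_closed
      unfolding mem_Supp_iff by meson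
  qed
qed

end
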